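(* For every $m\ge1$ and every assignment $A\in\{0,1\}^{(m+1)\times m}$ to the variables $x_{i,j}$ ($i\in[m+1]$, $j\in[m]$), $\mathrm{viol}_{\mathrm{PHP}^\delta}(A)=\mathrm{viol}_{\mathrm{PHP}_m}(A)-1$.
   Context: For a set $F$ of clauses and a total assignment $A$, $\mathrm{viol}_F(A)$ is the number of clauses of $F$ falsified by $A$. $\mathrm{PHP}_m$ consists of the pigeon axioms $\bigvee_{j=1}^m x_{i,j}$ for each $i\in[m+1]$, and the hole axioms $\neg x_{i,j}\vee\neg x_{i',j}$ for each $j\in[m]$ and $1\le i<i'\le m+1$. $\mathrm{PHP}^\delta=\bigcup_{i\in[m+1]}P_i^\delta\cup\bigcup_{j\in[m]}(H1_j^\delta\cup H2_j^\delta)$, where $$P_i^\delta=\Bigl\{\neg x_{i,j}\vee\bigl(\textstyle\bigvee_{j<\ell<k}x_{i,\ell}\bigr)\vee\neg x_{i,k}\;\Big|\;1\le j<k\le m\Bigr\},$$ $$H1_j^\delta=\Bigl\{\textstyle\bigvee_{i=1}^{m+1}x_{i,j}\Bigr\},$$ $$H2_j^\delta=\Bigl\{\neg x_{i,j}\vee\bigl(\textstyle\bigvee_{i<\ell<k}x_{\ell,j}\bigr)\vee\neg x_{k,j}\vee\neg x_{i',j}\;\Big|\;1\le i<k<i'\le m+1\Bigr\}.$$ *)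

theory Defs
  imports Main
begin

datatype 'v literal = Pos 'v | Neg 'v

type_synonym 'v clause = "'v literal set"

type_synonym 'v assignment = "'v \<Rightarrow> bool"

primrec lit_true :: "'v assignment \<Rightarrow> 'v literal \<Rightarrow> bool" where
  "lit_true A (Pos x) \<longleftrightarrow> A x"
| "lit_true A (Neg x) \<longleftrightarrow> \<not> A x"

definition satisfies :: "'v assignment \<Rightarrow> 'v clause \<Rightarrow> bool" where
  "satisfies A C \<longleftrightarrow> (\<exists>l\<in>C. lit_true A l)"

definition viol :: "'v clause set \<Rightarrow> 'v assignment \<Rightarrow> nat" where
  "viol F A = card {C \<in> F. \<not> satisfies A C}"

text \<open>The variable x_{i,j} (pigeon i sits in hole j) is the pair (i, j), with 1-based indices
  i in {1..m+1} and j in {1..m}. Values of an assignment at other pairs are irrelevant, since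
  no such pair occurs in the clause sets below.\<close>

type_synonym var = "nat \<times> nat"

definition pigeon_axiom :: "nat \<Rightarrow> nat \<Rightarrow> var clause" where
  "pigeon_axiom m i = {Pos (i, j) | j. j \<in> {1..m}}"

definition hole_axioms :: "nat \<Rightarrow> nat \<Rightarrow> var clause set" where
  "hole_axioms m j = {{Neg (i, j), Neg (i', j)} | i i'. 1 \<le> i \<and> i < i' \<and> i' \<le> m + 1}"

definition PHP :: "nat \<Rightarrow> var clause set" where
  "PHP m = pigeon_axiom m ` {1..m + 1} \<union> (\<Union>j\<in>{1..m}. hole_axioms m j)"

definition P_delta :: "nat \<Rightarrow> nat \<Rightarrow> var clause set" where
  "P_delta m i =
     {{Neg (i, j)} \<union> {Pos (i, l) | l. j < l \<and> l < k} \<union> {Neg (i, k)} | j k.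
        1 \<le> j \<and> j < k \<and> k \<le> m}"

definition H1_delta :: "nat \<Rightarrow> nat \<Rightarrow> var clause set" where
  "H1_delta m j = {{Pos (i, j) | i. i \<in> {1..m + 1}}}"

definition H2_delta :: "nat \<Rightarrow> nat \<Rightarrow> var clause set" where
  "H2_delta m j =
     {{Neg (i, j)} \<union> {Pos (l, j) | l. i < l \<and> l < k} \<union> {Neg (k, j), Neg (i', j)} | i k i'.
        1 \<le> i \<and> i < k \<and> k < i' \<and> i' \<le> m + 1}"

definition PHP_delta :: "nat \<Rightarrow> var clause set" where
  "PHP_delta m =
     (\<Union>i\<in>{1..m + 1}. P_delta m i) \<union> (\<Union>j\<in>{1..m}. H1_delta m j \<union> H2_delta m j)"

end

theory Submission imports Defs begin

text \<open>
  Let \<open>r\<^sub>i\<close> and \<open>c\<^sub>j\<close> be the numbers of true variables in row \<open>i\<close> and column \<open>j\<close>. A clause of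
  \<open>P\<^sub>i\<close> is falsified exactly by two consecutive ones of row \<open>i\<close>, so that \<open>r\<^sub>i - 1 + [r\<^sub>i = 0]\<close> of
  them are falsified. A clause of \<open>H2\<^sub>j\<close> is falsified by two consecutive ones and a later one of
  column \<open>j\<close>; as every pair of ones \<open>i < i'\<close> is either consecutive or determines such a triple,
  there are \<open>c\<^sub>j - 1 + [c\<^sub>j = 0]\<close> fewer of these than of falsified hole axioms. Finally \<open>H1\<^sub>j\<close>
  contributes \<open>[c\<^sub>j = 0]\<close>, the pigeon axioms contribute \<open>[r\<^sub>i = 0]\<close>, and the difference of the two
  counts is \<open>(\<Sum>i. r\<^sub>i - 1) - (\<Sum>j. c\<^sub>j - 1) = - (m + 1) + m = - 1\<close>, because \<open>(\<Sum>i. r\<^sub>i) = (\<Sum>j. c\<^sub>j)\<close>.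
\<close>

section \<open>Consecutive elements of finite linear orders\<close>

definition less_pairs :: "'a::linorder set \<Rightarrow> ('a \<times> 'a) set" where
  "less_pairs S = {(a, b). a \<in> S \<and> b \<in> S \<and> a < b}"

definition gaps :: "'a::linorder set \<Rightarrow> ('a \<times> 'a) set" where
  "gaps S = {(a, b). a \<in> S \<and> b \<in> S \<and> a < b \<and> (\<forall>l. a < l \<and> l < b \<longrightarrow> l \<notin> S)}"

definition gaps_beyond :: "'a::linorder set \<Rightarrow> ('a \<times> 'a \<times> 'a) set" where
  "gaps_beyond S = {(a, b, c). (a, b) \<in> gaps S \<and> c \<in> S \<and> b < c}"

lemma finite_gaps: "finite S \<Longrightarrow> finite (gaps S)"
  by (rule finite_subset[of _ "S \<times> S"]) (auto simp: gaps_def)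

lemma finite_less_pairs: "finite S \<Longrightarrow> finite (less_pairs S)"
  by (rule finite_subset[of _ "S \<times> S"]) (auto simp: less_pairs_def)

lemma finite_gaps_beyond: "finite S \<Longrightarrow> finite (gaps_beyond S)"
  by (rule finite_subset[of _ "S \<times> S \<times> S"]) (auto simp: gaps_beyond_def gaps_def)

lemma gaps_insert_max:
  assumes "finite S" "S \<noteq> {}" "\<forall>a\<in>S. a < x"
  shows "gaps (insert x S) = insert (Max S, x) (gaps S)"
proof -
  have Max: "Max S \<in> S" "\<And>a. a \<in> S \<Longrightarrow> a \<le> Max S" using assms by simp_all
  show ?thesis
  proof (intro equalityI subrelI)
    fix a b assume ab: "(a, b) \<in> gaps (insert x S)"
    then have a: "a \<in> S" using assms(3) by (auto simp: gaps_def dest: less_asym)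
    show "(a, b) \<in> insert (Max S, x) (gaps S)"
    proof (cases "b = x")
      case True
      \<comment> \<open>Otherwise \<open>Max S\<close> would lie strictly between \<open>a\<close>
        and \<open>x\<close>.\<close>
      then have "\<not> a < Max S" using ab Max(1) assms(3) by (auto simp: gaps_def)
      then show ?thesis using True Max(2)[OF a] by simp
    next
      case False
      then show ?thesis using ab a by (simp add: gaps_def)
    qed
  next
    fix a b assume "(a, b) \<in> insert (Max S, x) (gaps S)"
    then show "(a, b) \<in> gaps (insert x S)"
      using Max assms(3) by (auto simp: gaps_def dest: less_asym leD)
  qed
qed

text \<open>Each new maximum of a nonempty set opens exactly one gap, starting at the old maximum.
  The \<open>of_bool\<close> term corrects the empty set, and \<open>int\<close> avoids truncating
  \<open>0 - 1\<close>.\<close>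

lemma card_gaps:
  assumes "finite S"
  shows "int (card (gaps S)) = int (card S) - 1 + of_bool (S = {})"
  using assms
proof (induction rule: finite_linorder_max_induct)
  case empty
  then show ?case by (simp add: gaps_def)
next
  case (insert x S)
  show ?case
  proof (cases "S = {}")
    case True
    then have "gaps (insert x S) = {}" by (auto simp: gaps_def)
    then show ?thesis using True by simp
  next
    case False
    have "(Max S, x) \<notin> gaps S" and "x \<notin> S" using insert.hyps by (auto simp: gaps_def)
    then show ?thesis
      using insert gaps_insert_max[of S x] False by (simp add: finite_gaps)
  qed
qed

text \<open>Adjoining a maximum \<open>x\<close> to \<open>S\<close> adds \<open>card S\<close>
  pairs. Meanwhile \<open>gaps_beyond\<close> grows by one triple ending in \<open>x\<close> for
  each gap of \<open>S\<close>, which absorbs the summand \<open>card (gaps S)\<close> of the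
  induction hypothesis, and the enlarged set has exactly \<open>card S\<close> gaps.\<close>

lemma card_less_pairs:
  assumes "finite S"
  shows "card (less_pairs S) = card (gaps_beyond S) + card (gaps S)"
  using assms
proof (induction rule: finite_linorder_max_induct)
  case empty
  have "less_pairs {} = {}" "gaps_beyond {} = {}" "gaps {} = {}"
    by (auto simp: gaps_def less_pairs_def gaps_beyond_def)
  then show ?case by (metis card.empty add_0)
next
  case (insert x S)
  have x: "x \<notin> S" using insert.hyps by auto
  have "less_pairs (insert x S) = less_pairs S \<union> (\<lambda>a. (a, x)) ` S"
    using insert.hyps by (auto simp: less_pairs_def dest: less_asym)
  moreover have "less_pairs S \<inter> (\<lambda>a. (a, x)) ` S = {}"
    using x by (auto simp: less_pairs_def)
  ultimately have pairs: "card (less_pairs (insert x S)) = card (less_pairs S) + card S"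
    using insert.hyps by (simp add: card_Un_disjoint finite_less_pairs card_image inj_on_def)
  \<comment> \<open>Lying above all of \<open>S\<close>, the element \<open>x\<close> falls inside
    no gap of \<open>S\<close>; any new gap ends in \<open>x\<close>, and no triple continues beyond
    it.\<close>
  have "(a, b) \<in> gaps S \<longleftrightarrow> (a, b) \<in> gaps (insert x S) \<and> b < x" for a b
    using insert.hyps by (auto simp: gaps_def dest: less_asym)
  then have "gaps_beyond (insert x S) = gaps_beyond S \<union> (\<lambda>(a, b). (a, b, x)) ` gaps S"
    using insert.hyps by (auto simp: gaps_beyond_def dest: less_asym)
  moreover have "gaps_beyond S \<inter> (\<lambda>(a, b). (a, b, x)) ` gaps S = {}"
    using x by (auto simp: gaps_beyond_def)
  ultimately have "card (gaps_beyond (insert x S)) = card (gaps_beyond S) + card (gaps S)"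
    using insert.hyps
    by (simp add: card_Un_disjoint finite_gaps_beyond finite_gaps card_image inj_on_def split_def prod_eq_iff)
  moreover have "int (card (gaps (insert x S))) = int (card S)"
    using card_gaps[of "insert x S"] insert.hyps x by simp
  ultimately show ?case using pairs insert.IH by simp
qed

section \<open>Violations of unions and of families indexed by tuples\<close>

lemma card_filter_eq_sum: "finite S \<Longrightarrow> card {x \<in> S. P x} = (\<Sum>x\<in>S. of_bool (P x))"
  by (simp add: Int_def)

text \<open>A clause shared by two families would be counted only once, since \<open>viol\<close> is
  the cardinality of a set; hence disjointness here and in \<open>viol_UN\<close>, and injectivity
  in \<open>viol_image\<close>.\<close>

lemma viol_Un:
  assumes "finite F" "finite G" "F \<inter> G = {}"
  shows "viol (F \<union> G) A = viol F A + viol G A"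
proof -
  have "{C \<in> F \<union> G. \<not> satisfies A C} = {C \<in> F. \<not> satisfies A C} \<union> {C \<in> G. \<not> satisfies A C}"
    by auto
  then show ?thesis
    unfolding viol_def using assms by (auto intro!: card_Un_disjoint)
qed

lemma viol_UN:
  assumes "finite I" "\<And>i. i \<in> I \<Longrightarrow> finite (F i)"
    and "\<And>i j. i \<in> I \<Longrightarrow> j \<in> I \<Longrightarrow> i \<noteq> j \<Longrightarrow> F i \<inter> F j = {}"
  shows "viol (\<Union>i\<in>I. F i) A = (\<Sum>i\<in>I. viol (F i) A)"
proof -
  have "{C \<in> \<Union>i\<in>I. F i. \<not> satisfies A C} = (\<Union>i\<in>I. {C \<in> F i. \<not> satisfies A C})"
    by auto
  then show ?thesis
    unfolding viol_def using assms by (simp, intro card_UN_disjoint) (simp, simp, blast)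
qed

lemma viol_image:
  assumes "inj_on f I"
  shows "viol (f ` I) A = card {x \<in> I. \<not> satisfies A (f x)}"
proof -
  have "{C \<in> f ` I. \<not> satisfies A C} = f ` {x \<in> I. \<not> satisfies A (f x)}"
    by auto
  moreover have "inj_on f {x \<in> I. \<not> satisfies A (f x)}"
    using assms by (rule inj_on_subset) auto
  ultimately show ?thesis
    by (simp add: viol_def card_image)
qed

text \<open>An invariant of clauses: it recovers the index tuple of a P, hole or H2 clause, and its
  size and common row or column keep different clause sets apart.\<close>

definition neg_vars :: "'v clause \<Rightarrow> 'v set" where
  "neg_vars C = {v. Neg v \<in> C}"

definition P_clause :: "nat \<Rightarrow> nat \<times> nat \<Rightarrow> var clause" where
  "P_clause i = (\<lambda>(j, k). {Neg (i, j)} \<union> {Pos (i, l) | l. j < l \<and> l < k} \<union> {Neg (i, k)})"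

definition hole_clause :: "nat \<Rightarrow> nat \<times> nat \<Rightarrow> var clause" where
  "hole_clause j = (\<lambda>(i, i'). {Neg (i, j), Neg (i', j)})"

definition H2_clause :: "nat \<Rightarrow> nat \<times> nat \<times> nat \<Rightarrow> var clause" where
  "H2_clause j = (\<lambda>(i, k, i').
     {Neg (i, j)} \<union> {Pos (l, j) | l. i < l \<and> l < k} \<union> {Neg (k, j), Neg (i', j)})"

definition less_triples :: "'a::linorder set \<Rightarrow> ('a \<times> 'a \<times> 'a) set" where
  "less_triples S = {(a, b, c). a \<in> S \<and> b \<in> S \<and> c \<in> S \<and> a < b \<and> b < c}"

lemma finite_less_triples: "finite S \<Longrightarrow> finite (less_triples S)"
  by (rule finite_subset[of _ "S \<times> S \<times> S"]) (auto simp: less_triples_def)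

lemma P_delta_eq: "P_delta m i = P_clause i ` less_pairs {1..m}"
  unfolding P_delta_def P_clause_def less_pairs_def image_def
  by (intro Collect_cong, simp only: Bex_def split_paired_Ex mem_Collect_eq case_prod_conv,
      intro iff_exI, auto)

lemma hole_axioms_eq: "hole_axioms m j = hole_clause j ` less_pairs {1..m + 1}"
  unfolding hole_axioms_def hole_clause_def less_pairs_def image_def
  by (intro Collect_cong, simp only: Bex_def split_paired_Ex mem_Collect_eq case_prod_conv,
      intro iff_exI, auto)

lemma H2_delta_eq: "H2_delta m j = H2_clause j ` less_triples {1..m + 1}"
  unfolding H2_delta_def H2_clause_def less_triples_def image_def
  by (intro Collect_cong, simp only: Bex_def split_paired_Ex mem_Collect_eq case_prod_conv,
      intro iff_exI, auto)

lemma neg_vars_P_clause: "neg_vars (P_clause i (j, k)) = {(i, j), (i, k)}"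
  by (auto simp: neg_vars_def P_clause_def)

lemma neg_vars_hole_clause: "neg_vars (hole_clause j (i, i')) = {(i, j), (i', j)}"
  by (auto simp: neg_vars_def hole_clause_def)

lemma neg_vars_H2_clause: "neg_vars (H2_clause j (i, k, i')) = {(i, j), (k, j), (i', j)}"
  by (auto simp: neg_vars_def H2_clause_def)

lemma neg_vars_pigeon_axiom: "neg_vars (pigeon_axiom m i) = {}"
  by (auto simp: neg_vars_def pigeon_axiom_def)

lemma inj_P_clause: "inj_on (P_clause i) (less_pairs S)"
  by (rule inj_onI)
     (auto simp: less_pairs_def neg_vars_P_clause doubleton_eq_iff dest!: arg_cong[of _ _ neg_vars])

lemma inj_hole_clause: "inj_on (hole_clause j) (less_pairs S)"
  by (rule inj_onI)
     (auto simp: less_pairs_def neg_vars_hole_clause doubleton_eq_iff dest!: arg_cong[of _ _ neg_vars])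

lemma inj_H2_clause: "inj_on (H2_clause j) (less_triples S)"
proof (rule inj_onI)
  fix t t' assume t: "t \<in> less_triples S" "t' \<in> less_triples S"
    and eq: "H2_clause j t = H2_clause j t'"
  obtain a b c a' b' c' where s: "t = (a, b, c)" "t' = (a', b', c')" by (metis prod_cases3)
  have "fst ` neg_vars (H2_clause j t) = fst ` neg_vars (H2_clause j t')" using eq by simp
  then have "{a, b, c} = {a', b', c'}" by (simp add: s neg_vars_H2_clause)
  \<comment> \<open>Sorting turns equality of three-element sets into equality of increasing
    triples.\<close>
  then have "sorted_list_of_set {a, b, c} = sorted_list_of_set {a', b', c'}" by simp
  moreover have "sorted_list_of_set {a, b, c} = [a, b, c]"
      "sorted_list_of_set {a', b', c'} = [a', b', c']"
    using t by (auto simp: s less_triples_def)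
  ultimately show "t = t'" by (simp add: s)
qed

text \<open>The variable \<open>(i, 1)\<close> betrays the row. For \<open>m = 0\<close> all pigeon
  axioms would coincide with the empty clause.\<close>

lemma inj_pigeon_axiom: "m \<ge> 1 \<Longrightarrow> inj (pigeon_axiom m)"
proof (rule injI)
  fix i i' assume "m \<ge> 1" "pigeon_axiom m i = pigeon_axiom m i'"
  moreover from \<open>m \<ge> 1\<close> have "Pos (i, 1) \<in> pigeon_axiom m i" by (auto simp: pigeon_axiom_def)
  ultimately show "i = i'" by (auto simp: pigeon_axiom_def)
qed

section \<open>Violations family by family\<close>

lemma viol_P_delta: "viol (P_delta m i) A = card (gaps {j \<in> {1..m}. A (i, j)})"
proof -
  have "{p \<in> less_pairs {1..m}. \<not> satisfies A (P_clause i p)} = gaps {j \<in> {1..m}. A (i, j)}"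
    by (fastforce simp: less_pairs_def gaps_def satisfies_def P_clause_def)
  then show ?thesis by (simp add: P_delta_eq viol_image inj_P_clause)
qed

lemma viol_hole_axioms: "viol (hole_axioms m j) A = card (less_pairs {i \<in> {1..m + 1}. A (i, j)})"
proof -
  have "{p \<in> less_pairs {1..m + 1}. \<not> satisfies A (hole_clause j p)}
      = less_pairs {i \<in> {1..m + 1}. A (i, j)}"
    by (auto simp: less_pairs_def satisfies_def hole_clause_def)
  then show ?thesis unfolding hole_axioms_eq by (subst viol_image) (simp_all add: inj_hole_clause)
qed

lemma viol_H2_delta: "viol (H2_delta m j) A = card (gaps_beyond {i \<in> {1..m + 1}. A (i, j)})"
proof -
  have "{p \<in> less_triples {1..m + 1}. \<not> satisfies A (H2_clause j p)}
      = gaps_beyond {i \<in> {1..m + 1}. A (i, j)}"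
    by (fastforce simp: less_triples_def gaps_beyond_def gaps_def satisfies_def H2_clause_def)
  then show ?thesis unfolding H2_delta_eq by (subst viol_image) (simp_all add: inj_H2_clause)
qed

lemma viol_H1_delta: "viol (H1_delta m j) A = of_bool ({i \<in> {1..m + 1}. A (i, j)} = {})"
proof -
  \<comment> \<open>Seen as an image of a one-point index set, the singleton falls under
    \<open>viol_image\<close>.\<close>
  have "H1_delta m j = (\<lambda>_. {Pos (i, j) | i. i \<in> {1..m + 1}}) ` {()}"
    by (auto simp: H1_delta_def)
  moreover have "satisfies A {Pos (i, j) | i. i \<in> {1..m + 1}} \<longleftrightarrow> {i \<in> {1..m + 1}. A (i, j)} \<noteq> {}"
    by (fastforce simp: satisfies_def)
  ultimately show ?thesis
    by (subst \<open>H1_delta m j = _\<close>, subst viol_image) (simp_all add: of_bool_def)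
qed

lemma viol_pigeon_axioms:
  assumes "m \<ge> 1"
  shows "viol (pigeon_axiom m ` I) A = card {i \<in> I. {j \<in> {1..m}. A (i, j)} = {}}"
proof -
  have "satisfies A (pigeon_axiom m i) \<longleftrightarrow> {j \<in> {1..m}. A (i, j)} \<noteq> {}" for i
    by (fastforce simp: satisfies_def pigeon_axiom_def)
  moreover have inj: "inj_on (pigeon_axiom m) I"
    using inj_pigeon_axiom[OF assms] by (rule inj_on_subset) simp
  ultimately show ?thesis
    by (simp only: viol_image[OF inj] not_not)
qed

section \<open>The two total counts\<close>

lemma viol_PHP:
  assumes "m \<ge> 1"
  shows "viol (PHP m) A = (\<Sum>i\<in>{1..m + 1}. of_bool ({j \<in> {1..m}. A (i, j)} = {}))
    + (\<Sum>j\<in>{1..m}. card (less_pairs {i \<in> {1..m + 1}. A (i, j)}))"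
proof -
  have fin: "finite (hole_axioms m j)" for j
    by (simp add: hole_axioms_eq finite_less_pairs)
  have disj: "hole_axioms m j \<inter> hole_axioms m j' = {}" if "j \<noteq> j'" for j j'
    using that unfolding hole_axioms_eq
    by (auto simp: neg_vars_hole_clause doubleton_eq_iff dest!: arg_cong[of _ _ neg_vars])
  have "viol (PHP m) A = viol (pigeon_axiom m ` {1..m + 1}) A + viol (\<Union>j\<in>{1..m}. hole_axioms m j) A"
    unfolding PHP_def
  proof (rule viol_Un)
    \<comment> \<open>Every hole axiom has negated variables, a pigeon axiom has none.\<close>
    show "pigeon_axiom m ` {1..m + 1} \<inter> (\<Union>j\<in>{1..m}. hole_axioms m j) = {}"
      unfolding hole_axioms_eq
      by (auto simp: neg_vars_hole_clause neg_vars_pigeon_axiom dest!: arg_cong[of _ _ neg_vars])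
  qed (simp_all add: fin)
  also have "viol (\<Union>j\<in>{1..m}. hole_axioms m j) A = (\<Sum>j\<in>{1..m}. viol (hole_axioms m j) A)"
    using fin disj by (intro viol_UN) auto
  finally show ?thesis
    unfolding viol_pigeon_axioms[OF assms] viol_hole_axioms
    by (simp only: card_filter_eq_sum finite_atLeastAtMost)
qed

lemma viol_PHP_delta:
  "viol (PHP_delta m) A = (\<Sum>i\<in>{1..m + 1}. card (gaps {j \<in> {1..m}. A (i, j)}))
    + (\<Sum>j\<in>{1..m}. of_bool ({i \<in> {1..m + 1}. A (i, j)} = {})
        + card (gaps_beyond {i \<in> {1..m + 1}. A (i, j)}))"
proof -
  \<comment> \<open>The sizes 2, 0 and 3 of \<open>neg_vars\<close> separate P, H1 and H2 clauses;
    the common row or column separates members of the same kind.\<close>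
  have P: "fst ` neg_vars C = {i} \<and> card (neg_vars C) = 2" if "C \<in> P_delta m i" for C i
    using that by (auto simp: P_delta_eq less_pairs_def neg_vars_P_clause)
  \<comment> \<open>Without negated variables, an H1 clause shows its column through its positive
    ones; \<open>Pos (1, j)\<close> witnesses that there is one.\<close>
  have H1: "neg_vars C = {} \<and> (\<forall>v. Pos v \<in> C \<longrightarrow> snd v = j) \<and> Pos (1, j) \<in> C"
    if "C \<in> H1_delta m j" for C j
    using that by (auto simp: H1_delta_def neg_vars_def)
  have H2: "snd ` neg_vars C = {j} \<and> card (neg_vars C) = 3"
    if "C \<in> H2_delta m j" for C j
    using that by (auto simp: H2_delta_eq less_triples_def neg_vars_H2_clause)
  have finP: "finite (P_delta m i)" for i
    by (simp add: P_delta_eq finite_less_pairs)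
  have finH1: "finite (H1_delta m j)" and finH2: "finite (H2_delta m j)" for j
    by (simp_all add: H1_delta_def H2_delta_eq finite_less_triples)
  have disjP: "P_delta m i \<inter> P_delta m i' = {}" if "i \<noteq> i'" for i i'
    using P that by (metis disjoint_iff singleton_inject)
  have disjH12: "H1_delta m j \<inter> H2_delta m j' = {}" for j j'
    using H1 H2 by (metis disjoint_iff image_empty insert_not_empty)
  have disjH1: "H1_delta m j \<inter> H1_delta m j' = {}" if "j \<noteq> j'" for j j'
    using H1 that by (metis disjoint_iff snd_conv)
  have disjH2: "H2_delta m j \<inter> H2_delta m j' = {}" if "j \<noteq> j'" for j j'
    using H2 that by (metis disjoint_iff singleton_inject)
  have disjPH: "P_delta m i \<inter> (H1_delta m j \<union> H2_delta m j) = {}" for i j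
  proof -
    have "C \<notin> H1_delta m j \<and> C \<notin> H2_delta m j" if "C \<in> P_delta m i" for C
      using P[OF that] H1[of C j] H2[of C j] by auto
    then show ?thesis by blast
  qed
  have "viol (PHP_delta m) A = viol (\<Union>i\<in>{1..m + 1}. P_delta m i) A
      + viol (\<Union>j\<in>{1..m}. H1_delta m j \<union> H2_delta m j) A"
    unfolding PHP_delta_def
    by (rule viol_Un) (use disjPH in \<open>auto simp: finP finH1 finH2\<close>)
  also have "viol (\<Union>i\<in>{1..m + 1}. P_delta m i) A = (\<Sum>i\<in>{1..m + 1}. viol (P_delta m i) A)"
    using finP disjP by (intro viol_UN) auto
  also have "viol (\<Union>j\<in>{1..m}. H1_delta m j \<union> H2_delta m j) A
      = (\<Sum>j\<in>{1..m}. viol (H1_delta m j \<union> H2_delta m j) A)"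
    by (intro viol_UN)
       (use disjH1 disjH2 disjH12 in \<open>simp_all add: finH1 finH2 Int_Un_distrib Int_Un_distrib2 Int_commute\<close>)
  also have "\<dots> = (\<Sum>j\<in>{1..m}. viol (H1_delta m j) A + viol (H2_delta m j) A)"
    by (simp add: viol_Un finH1 finH2 disjH12)
  finally show ?thesis
    unfolding viol_P_delta viol_H1_delta viol_H2_delta .
qed

section \<open>Double counting and the final balance\<close>

lemma sum_card_rows_eq_columns:
  assumes "finite I" "finite J"
  shows "(\<Sum>i\<in>I. card {j \<in> J. R i j}) = (\<Sum>j\<in>J. card {i \<in> I. R i j})"
  unfolding card_filter_eq_sum[OF assms(1)] card_filter_eq_sum[OF assms(2)] by (rule sum.swap)

theorem theorem4p5:
  fixes m :: nat and A :: "var assignment"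
  assumes "m \<ge> 1"
  shows "int (viol (PHP_delta m) A) = int (viol (PHP m) A) - 1"
proof -
  define R where "R i = {j \<in> {1..m}. A (i, j)}" for i
  define C where "C j = {i \<in> {1..m + 1}. A (i, j)}" for j
  have fin: "finite (R i)" "finite (C j)" for i j by (simp_all add: R_def C_def)
  have "int (viol (PHP_delta m) A) = (\<Sum>i\<in>{1..m + 1}. int (card (gaps (R i))))
      + (\<Sum>j\<in>{1..m}. of_bool (C j = {}) + int (card (gaps_beyond (C j))))"
    by (simp only: viol_PHP_delta R_def C_def of_nat_add of_nat_sum of_nat_of_bool)
  moreover have "int (viol (PHP m) A) = (\<Sum>i\<in>{1..m + 1}. of_bool (R i = {}))
      + (\<Sum>j\<in>{1..m}. int (card (less_pairs (C j))))"
    by (simp only: viol_PHP[OF assms] R_def C_def of_nat_add of_nat_sum of_nat_of_bool)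
  \<comment> \<open>The empty-row correction of \<open>card_gaps\<close> is exactly the contribution
    of the violated pigeon axioms.\<close>
  moreover have "(\<Sum>i\<in>{1..m + 1}. int (card (gaps (R i))))
      = (\<Sum>i\<in>{1..m + 1}. int (card (R i))) - int (m + 1) + (\<Sum>i\<in>{1..m + 1}. of_bool (R i = {}))"
    by (simp only: card_gaps[OF fin(1)] sum.distrib sum_subtractf) simp
  \<comment> \<open>The H1 violation cancels the empty-column correction of
    \<open>card_gaps\<close>, so every column, empty or not, leaves the same
    \<open>+ 1\<close>.\<close>
  moreover have "of_bool (C j = {}) + int (card (gaps_beyond (C j)))
      = int (card (less_pairs (C j))) - int (card (C j)) + 1" for j
    using card_gaps[OF fin(2)[of j]] card_less_pairs[OF fin(2)[of j]] by linarith
  then have "(\<Sum>j\<in>{1..m}. of_bool (C j = {}) + int (card (gaps_beyond (C j))))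
      = (\<Sum>j\<in>{1..m}. int (card (less_pairs (C j)))) - (\<Sum>j\<in>{1..m}. int (card (C j))) + int m"
    by (simp add: sum.distrib sum_subtractf)
  moreover have "(\<Sum>j\<in>{1..m}. int (card (C j))) = (\<Sum>i\<in>{1..m + 1}. int (card (R i)))"
    unfolding R_def C_def of_nat_sum[symmetric]
    by (subst sum_card_rows_eq_columns) simp_all
  ultimately show ?thesis by linarith
qed

end
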